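(* Let $(S,E)$ be a Weyl $*$-semigroup with a uniformly continuous action on a uniform space $(X,\mathfrak{F})$, and let $\Psi:X\to X$ be an $E$-equivariant map. Let $\mathcal{W}=\mathcal{W}(X)$ be the associated Weyl bundle over the Weyl groupoid $\mathcal{U}(S)$. Then every $x\in X$ defines a continuous section $\widehat{x}:\mathcal{U}(S)\to\mathcal{W}$ of $\mathcal{W}$ given by \[\widehat{x}(U)=(U,x^{\equiv_U}).\]
   Context: A $*$-semigroup is a semigroup $S$ with a unary operation $a\mapsto a^*$ satisfying $a^{**}=a$ and $(ab)^*=b^*a^*$. A Weyl $*$-semigroup $(S,E)$ is a $*$-semigroup $S$ with a subset $E$ such that $EE\subseteq E=E^*$, $a^*Ea\subseteq E$ for all $a\in S$, and for every $a\in S$ the element $a^*a$ lies in $E$ and commutes with every element of $E$. For $a,b\in S$: $a\precsim b$ iff $ab^*\in E$ and $a=ab^*b$. A filter is a non-empty $U\subseteq S$ such that for all $a,b\in S$: $a,b\in U$ iff there is $c\in U$ with $c\precsim a$ and $c\precsim b$. An ultrafilter is a filter $U\neq S$ maximal among filters different from $S$. $\mathcal{U}(S)$ is the set of ultrafilters with the topology generated by $\mathcal{U}_a=\{U\in\mathcal{U}(S):a\in U\}$, $a\in S$. A uniformity on $X$ is a family $\mathfrak{F}$ of symmetric reflexive relations on $X$ which is a filter in the inclusion-ordered set of symmetric reflexive relations and such that for every $\mathsf{R}\in\mathfrak{F}$ there is $\mathsf{Q}\in\mathfrak{F}$ with $\mathsf{Q}\circ\mathsf{Q}\subseteq\mathsf{R}$.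 An action of $S$ on $X$ is a map $(s,x)\mapsto sx$ from $S\times X$ to $X$ with $(st)x=s(tx)$; it is uniformly continuous if for every $\mathsf{R}\in\mathfrak{F}$ there is $\mathsf{Q}\in\mathfrak{F}$ with $\{(sx,sy):s\in S,(x,y)\in\mathsf{Q}\}\subseteq\mathsf{R}$. $\Psi$ is $E$-equivariant if $\Psi(ex)=e\Psi(x)$ for all $e\in E$, $x\in X$. For $U\subseteq S$ and $\mathsf{R}\in\mathfrak{F}$: $x\mathrel{\mathsf{R}_U}y$ iff there is $u\in U$ with $\Psi(u^*x)\mathrel{\mathsf{R}}\Psi(u^*y)$; and $x\equiv_Uy$ iff $x\mathrel{\mathsf{R}_U}y$ for all $\mathsf{R}\in\mathfrak{F}$. For $U\in\mathcal{U}(S)$, $\equiv_U$ is an equivalence relation on $X$, and $x^{\equiv_U}$ denotes the equivalence class of $x$. The Weyl bundle is $\mathcal{W}=\{(U,x^{\equiv_U}):U\in\mathcal{U}(S),x\in X\}$, with projection $\pi((U,Y))=U$ onto the first coordinate; a section is a map $\sigma$ with $\pi\circ\sigma=\mathrm{id}$. For $x\in X$, $s\in S$, $\mathsf{R}\in\mathfrak{F}$ put $x_s^{\mathsf{R}}=\{(U,y^{\equiv_U})\in\mathcal{W}:s\in U\text{ and }x\mathrel{\mathsf{R}_U}y\}$ (so $(U,Y)\in x_s^{\mathsf{R}}$ iff $s\in U$ and $x\mathrel{\mathsf{R}_U}y$ for some $y\in Y$). The topology of $\mathcal{W}$ is the one in which, at each $(U,Y)\in\mathcal{W}$, the family $\{y_s^{\mathsf{R}}:s\in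 U,\ y\in Y,\ \mathsf{R}\in\mathfrak{F}\}$ is a neighbourhood subbase. *)

theory Defs
  imports "HOL-Analysis.Analysis"
begin

text \<open>The semigroup \<open>S\<close> is a type of class \<^class>\<open>semigroup_mult\<close>, and \<open>X\<close> is a type without any
  class constraint; involution, action and uniformity are explicit parameters.\<close>

locale star_semigroup =
  fixes star :: "'s::semigroup_mult \<Rightarrow> 's"
  assumes star_star: "star (star a) = a"
    and star_mult: "star (a * b) = star b * star a"

locale weyl_star_semigroup = star_semigroup star
  for star :: "'s::semigroup_mult \<Rightarrow> 's" +
  fixes E :: "'s set"
  assumes E_mult: "d \<in> E \<Longrightarrow> e \<in> E \<Longrightarrow> d * e \<in> E"
    and E_star: "star ` E = E"
    and E_conj: "e \<in> E \<Longrightarrow> star a * e * a \<in> E"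
    and E_source: "star a * a \<in> E"
    and E_source_commute: "e \<in> E \<Longrightarrow> star a * a * e = e * (star a * a)"

definition weyl_prec :: "('s::semigroup_mult \<Rightarrow> 's) \<Rightarrow> 's set \<Rightarrow> 's \<Rightarrow> 's \<Rightarrow> bool" where
  "weyl_prec star E a b \<longleftrightarrow> a * star b \<in> E \<and> a = a * star b * b"

text \<open>Used both for \<open>(S, \<precsim>)\<close> and for the symmetric reflexive relations ordered by inclusion.\<close>

definition filter_in :: "'a set \<Rightarrow> ('a \<Rightarrow> 'a \<Rightarrow> bool) \<Rightarrow> 'a set \<Rightarrow> bool" where
  "filter_in A le U \<longleftrightarrow> U \<subseteq> A \<and> U \<noteq> {} \<and>
     (\<forall>a\<in>A. \<forall>b\<in>A. (a \<in> U \<and> b \<in> U) \<longleftrightarrow> (\<exists>c\<in>U. le c a \<and> le c b))"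

definition ultrafilter_in :: "'a set \<Rightarrow> ('a \<Rightarrow> 'a \<Rightarrow> bool) \<Rightarrow> 'a set \<Rightarrow> bool" where
  "ultrafilter_in A le U \<longleftrightarrow> filter_in A le U \<and> U \<noteq> A \<and>
     (\<forall>V. filter_in A le V \<and> V \<noteq> A \<and> U \<subseteq> V \<longrightarrow> V = U)"

definition weyl_ultrafilters :: "('s::semigroup_mult \<Rightarrow> 's) \<Rightarrow> 's set \<Rightarrow> 's set set" where
  "weyl_ultrafilters star E = {U. ultrafilter_in UNIV (weyl_prec star E) U}"

definition ultrafilter_topology :: "('s::semigroup_mult \<Rightarrow> 's) \<Rightarrow> 's set \<Rightarrow> 's set topology" where
  "ultrafilter_topology star E =
     topology_generated_by (range (\<lambda>a. {U \<in> weyl_ultrafilters star E. a \<in> U}))"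

definition uniformity_family :: "'x rel set \<Rightarrow> bool" where
  "uniformity_family F \<longleftrightarrow> filter_in {R. refl R \<and> sym R} (\<subseteq>) F \<and> (\<forall>R\<in>F. \<exists>Q\<in>F. Q O Q \<subseteq> R)"

definition is_action :: "('s::semigroup_mult \<Rightarrow> 'x \<Rightarrow> 'x) \<Rightarrow> bool" where
  "is_action act \<longleftrightarrow> (\<forall>s t x. act (s * t) x = act s (act t x))"

definition uniformly_continuous_action :: "'x rel set \<Rightarrow> ('s::semigroup_mult \<Rightarrow> 'x \<Rightarrow> 'x) \<Rightarrow> bool" where
  "uniformly_continuous_action F act \<longleftrightarrow>
     (\<forall>R\<in>F. \<exists>Q\<in>F. {(act s x, act s y) | s x y. (x, y) \<in> Q} \<subseteq> R)"

definition equivariant_on :: "'s set \<Rightarrow> ('s::semigroup_mult \<Rightarrow> 'x \<Rightarrow> 'x) \<Rightarrow> ('x \<Rightarrow> 'x) \<Rightarrow> bool" where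
  "equivariant_on E act \<Psi> \<longleftrightarrow> (\<forall>e\<in>E. \<forall>x. \<Psi> (act e x) = act e (\<Psi> x))"

definition rel_at ::
    "('s::semigroup_mult \<Rightarrow> 's) \<Rightarrow> ('s \<Rightarrow> 'x \<Rightarrow> 'x) \<Rightarrow> ('x \<Rightarrow> 'x) \<Rightarrow> 's set \<Rightarrow> 'x rel \<Rightarrow> 'x rel" where
  "rel_at star act \<Psi> U R = {(x, y). \<exists>u\<in>U. (\<Psi> (act (star u) x), \<Psi> (act (star u) y)) \<in> R}"

definition equiv_at ::
    "('s::semigroup_mult \<Rightarrow> 's) \<Rightarrow> 'x rel set \<Rightarrow> ('s \<Rightarrow> 'x \<Rightarrow> 'x) \<Rightarrow> ('x \<Rightarrow> 'x) \<Rightarrow> 's set \<Rightarrow> 'x rel" where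
  "equiv_at star F act \<Psi> U = {(x, y). \<forall>R\<in>F. (x, y) \<in> rel_at star act \<Psi> U R}"

definition weyl_bundle ::
    "('s::semigroup_mult \<Rightarrow> 's) \<Rightarrow> 's set \<Rightarrow> 'x rel set \<Rightarrow> ('s \<Rightarrow> 'x \<Rightarrow> 'x) \<Rightarrow> ('x \<Rightarrow> 'x) \<Rightarrow>
     ('s set \<times> 'x set) set" where
  "weyl_bundle star E F act \<Psi> =
     {(U, equiv_at star F act \<Psi> U `` {x}) | U x. U \<in> weyl_ultrafilters star E}"

definition weyl_nhood ::
    "('s::semigroup_mult \<Rightarrow> 's) \<Rightarrow> 's set \<Rightarrow> 'x rel set \<Rightarrow> ('s \<Rightarrow> 'x \<Rightarrow> 'x) \<Rightarrow> ('x \<Rightarrow> 'x) \<Rightarrow>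
     'x \<Rightarrow> 's \<Rightarrow> 'x rel \<Rightarrow> ('s set \<times> 'x set) set" where
  "weyl_nhood star E F act \<Psi> x s R =
     {(U, equiv_at star F act \<Psi> U `` {y}) | U y.
        U \<in> weyl_ultrafilters star E \<and> s \<in> U \<and> (x, y) \<in> rel_at star act \<Psi> U R}"

definition weyl_subbase ::
    "('s::semigroup_mult \<Rightarrow> 's) \<Rightarrow> 's set \<Rightarrow> 'x rel set \<Rightarrow> ('s \<Rightarrow> 'x \<Rightarrow> 'x) \<Rightarrow> ('x \<Rightarrow> 'x) \<Rightarrow>
     's set \<times> 'x set \<Rightarrow> ('s set \<times> 'x set) set set" where
  "weyl_subbase star E F act \<Psi> = (\<lambda>(U, Y).
     {weyl_nhood star E F act \<Psi> y s R | y s R. s \<in> U \<and> y \<in> Y \<and> R \<in> F})"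

text \<open>The members of a neighbourhood subbase are neighbourhoods, but need not be open.\<close>

definition nhood_subbase_at :: "'a topology \<Rightarrow> 'a \<Rightarrow> 'a set set \<Rightarrow> bool" where
  "nhood_subbase_at T p B \<longleftrightarrow>
     (\<forall>N\<in>B. \<exists>V. openin T V \<and> p \<in> V \<and> V \<subseteq> N) \<and>
     (\<forall>V. openin T V \<and> p \<in> V \<longrightarrow> (\<exists>G. finite G \<and> G \<subseteq> B \<and> topspace T \<inter> \<Inter>G \<subseteq> V))"

definition weyl_topology ::
    "('s::semigroup_mult \<Rightarrow> 's) \<Rightarrow> 's set \<Rightarrow> 'x rel set \<Rightarrow> ('s \<Rightarrow> 'x \<Rightarrow> 'x) \<Rightarrow> ('x \<Rightarrow> 'x) \<Rightarrow>
     ('s set \<times> 'x set) topology" where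
  "weyl_topology star E F act \<Psi> =
     (THE T. topspace T = weyl_bundle star E F act \<Psi> \<and>
        (\<forall>p \<in> weyl_bundle star E F act \<Psi>. nhood_subbase_at T p (weyl_subbase star E F act \<Psi> p)))"

definition continuous_section :: "'b topology \<Rightarrow> 'w topology \<Rightarrow> ('w \<Rightarrow> 'b) \<Rightarrow> ('b \<Rightarrow> 'w) \<Rightarrow> bool" where
  "continuous_section B W \<pi> \<sigma> \<longleftrightarrow> continuous_map B W \<sigma> \<and> (\<forall>b\<in>topspace B. \<pi> (\<sigma> b) = b)"

lemma topspace_ultrafilter_topology:
  "topspace (ultrafilter_topology star E) = weyl_ultrafilters star E"
  unfolding ultrafilter_topology_def topology_generated_by_topspace
  by (auto simp: weyl_ultrafilters_def ultrafilter_in_def filter_in_def)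

text \<open>The definite description in \<open>weyl_topology\<close> is justified by the following results, up to
  \<open>weyl_topology_ex1\<close>.\<close>

lemma openin_nhood_subbase_iff:
  assumes "topspace T = W" and sb: "\<And>p. p \<in> W \<Longrightarrow> nhood_subbase_at T p (B p)"
  shows "openin T V \<longleftrightarrow>
    V \<subseteq> W \<and> (\<forall>p\<in>V. \<exists>G. finite G \<and> G \<subseteq> B p \<and> W \<inter> \<Inter>G \<subseteq> V)" (is "_ \<longleftrightarrow> ?R")
proof
  assume "openin T V"
  then show ?R
    using assms openin_subset[of T V] unfolding nhood_subbase_at_def by blast
next
  assume R: ?R
  show "openin T V"
  proof (subst openin_subopen, intro ballI)
    fix p assume p: "p \<in> V"
    then obtain G where G: "finite G" "G \<subseteq> B p" "W \<inter> \<Inter>G \<subseteq> V" using R by blast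
    have pW: "p \<in> W" using p R by blast
    have "\<forall>N\<in>G. \<exists>O'. openin T O' \<and> p \<in> O' \<and> O' \<subseteq> N"
      using sb[OF pW] G(2) unfolding nhood_subbase_at_def by blast
    then obtain h where h: "\<And>N. N \<in> G \<Longrightarrow> openin T (h N) \<and> p \<in> h N \<and> h N \<subseteq> N" by metis
    have "openin T (topspace T \<inter> \<Inter>(h ` G))"
      using G(1) h openin_Inter[of "insert (topspace T) (h ` G)" T] by auto
    moreover have "p \<in> topspace T \<inter> \<Inter>(h ` G)" using pW assms(1) h by auto
    moreover have "topspace T \<inter> \<Inter>(h ` G) \<subseteq> V" using G(3) h assms(1) by fast
    ultimately show "\<exists>O'. openin T O' \<and> p \<in> O' \<and> O' \<subseteq> V" by blast
  qed
qed

lemma nhood_subbase_topology_ex1: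
  assumes mem: "\<And>p N. p \<in> W \<Longrightarrow> N \<in> B p \<Longrightarrow> p \<in> N"
    and ref: "\<And>p N. p \<in> W \<Longrightarrow> N \<in> B p \<Longrightarrow>
      \<exists>C\<in>B p. \<forall>q\<in>W \<inter> C. \<exists>D\<in>B q. D \<subseteq> N"
  shows "\<exists>!T. topspace T = W \<and> (\<forall>p\<in>W. nhood_subbase_at T p (B p))"
proof (rule ex_ex1I)
  define Op where "Op = (\<lambda>V. V \<subseteq> W \<and> (\<forall>p\<in>V. \<exists>G. finite G \<and> G \<subseteq> B p \<and> W \<inter> \<Inter>G \<subseteq> V))"
  have top: "istopology Op"
    unfolding istopology_def
  proof (intro conjI allI impI)
    fix V V' assume "Op V" "Op V'"
    show "Op (V \<inter> V')" unfolding Op_def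
    proof (intro conjI ballI)
      show "V \<inter> V' \<subseteq> W" using \<open>Op V\<close> Op_def by blast
    next
      fix p assume p: "p \<in> V \<inter> V'"
      obtain G where "finite G" "G \<subseteq> B p" "W \<inter> \<Inter>G \<subseteq> V" using \<open>Op V\<close> p Op_def by blast
      moreover obtain G' where "finite G'" "G' \<subseteq> B p" "W \<inter> \<Inter>G' \<subseteq> V'"
        using \<open>Op V'\<close> p Op_def by blast
      ultimately show "\<exists>G. finite G \<and> G \<subseteq> B p \<and> W \<inter> \<Inter>G \<subseteq> V \<inter> V'"
        by (intro exI[of _ "G \<union> G'"]) auto
    qed
  next
    fix K assume K: "\<forall>V\<in>K. Op V"
    show "Op (\<Union>K)" unfolding Op_def
    proof (intro conjI ballI)
      show "\<Union>K \<subseteq> W" using K Op_def by blast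
    next
      fix p assume "p \<in> \<Union>K"
      then obtain V where V: "V \<in> K" "p \<in> V" by blast
      then have "\<exists>G. finite G \<and> G \<subseteq> B p \<and> W \<inter> \<Inter>G \<subseteq> V" using K Op_def by blast
      then show "\<exists>G. finite G \<and> G \<subseteq> B p \<and> W \<inter> \<Inter>G \<subseteq> \<Union>K" using V(1) by blast
    qed
  qed
  define T where "T = topology Op"
  have op: "openin T V \<longleftrightarrow> Op V" for V using top by (simp add: T_def topology_inverse')
  have OpW: "Op W" unfolding Op_def by blast
  have tsp: "topspace T = W"
    using OpW op openin_subset[of T W] openin_topspace[of T] Op_def by blast
  have "nhood_subbase_at T p (B p)" if p: "p \<in> W" for p
    unfolding nhood_subbase_at_def
  proof (intro conjI ballI allI impI)
    fix N assume N: "N \<in> B p"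
    define V where "V = {q \<in> W. \<exists>G. finite G \<and> G \<subseteq> B q \<and> W \<inter> \<Inter>G \<subseteq> N}"
    have "p \<in> V" using p N unfolding V_def by (auto intro: exI[of _ "{N}"])
    moreover have "V \<subseteq> N" using mem unfolding V_def by blast
    moreover have "Op V" unfolding Op_def
    proof (intro conjI ballI)
      show "V \<subseteq> W" unfolding V_def by blast
    next
      fix q assume "q \<in> V"
      then obtain G where q: "q \<in> W" and G: "finite G" "G \<subseteq> B q" "W \<inter> \<Inter>G \<subseteq> N"
        unfolding V_def by blast
      have "\<forall>M\<in>G. \<exists>C\<in>B q. \<forall>r\<in>W \<inter> C. \<exists>D\<in>B r. D \<subseteq> M" using ref[OF q] G(2) by blast
      then obtain c where c: "\<And>M. M \<in> G \<Longrightarrow> c M \<in> B q \<and> (\<forall>r\<in>W \<inter> c M. \<exists>D\<in>B r. D \<subseteq> M)"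
        by metis
      have "W \<inter> \<Inter>(c ` G) \<subseteq> V"
      proof
        fix r assume r: "r \<in> W \<inter> \<Inter>(c ` G)"
        then have "\<forall>M\<in>G. \<exists>D\<in>B r. D \<subseteq> M" using c by blast
        then obtain d where d: "\<And>M. M \<in> G \<Longrightarrow> d M \<in> B r \<and> d M \<subseteq> M" by metis
        have "W \<inter> \<Inter>(d ` G) \<subseteq> N" using d G(3) by fast
        then show "r \<in> V" using r d G(1) unfolding V_def
          by (auto intro!: exI[of _ "d ` G"])
      qed
      then show "\<exists>G. finite G \<and> G \<subseteq> B q \<and> W \<inter> \<Inter>G \<subseteq> V"
        using c G(1) by (intro exI[of _ "c ` G"]) auto
    qed
    ultimately show "\<exists>V. openin T V \<and> p \<in> V \<and> V \<subseteq> N" using op by blast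
  next
    fix V assume "openin T V \<and> p \<in> V"
    then show "\<exists>G. finite G \<and> G \<subseteq> B p \<and> topspace T \<inter> \<Inter>G \<subseteq> V"
      using op tsp unfolding Op_def by blast
  qed
  then show "\<exists>T. topspace T = W \<and> (\<forall>p\<in>W. nhood_subbase_at T p (B p))" using tsp by blast
next
  fix T T'
  assume "topspace T = W \<and> (\<forall>p\<in>W. nhood_subbase_at T p (B p))"
    and "topspace T' = W \<and> (\<forall>p\<in>W. nhood_subbase_at T' p (B p))"
  then have "openin T V = openin T' V" for V
    using openin_nhood_subbase_iff[of T W B V] openin_nhood_subbase_iff[of T' W B V] by simp
  then show "T = T'" by (simp add: topology_eq)
qed

lemma (in weyl_star_semigroup) weyl_prec_eq_right_mult:
  assumes "weyl_prec star E c v"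
  obtains e where "e \<in> E" "star c = e * star v"
proof -
  have cE: "c * star v \<in> E" and c: "c = c * star v * v"
    using assms by (auto simp: weyl_prec_def)
  have "star (c * star v) \<in> E" using cE E_star by blast
  then have "v * star c \<in> E" by (simp add: star_mult star_star)
  then have "star v * (v * star c) * v \<in> E" by (rule E_conj)
  have vv: "v * star v \<in> E" "\<And>e. e \<in> E \<Longrightarrow> v * star v * e = e * (v * star v)"
    using E_source[of "star v"] E_source_commute[of _ "star v"] by (auto simp: star_star)
  have cv: "v * star v * c = v * star v * (c * star v) * v"
    using arg_cong[OF c, of "\<lambda>d. v * star v * d"] by (simp only: mult.assoc)
  have cc: "c * star v * (v * star v) * v = c"
    using arg_cong[OF c, of "\<lambda>d. d * star v * v"] c[symmetric] by (simp only: mult.assoc)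
  have "v * star v * c = c" unfolding cv vv(2)[OF cE] by (rule cc)
  then have "star c = star (v * star v * c)" by (rule arg_cong[OF sym])
  then have eq: "star c = star c * v * star v" by (simp add: star_mult star_star mult.assoc)
  have "star v * c = star v * (c * star v) * v"
    using arg_cong[OF c, of "\<lambda>d. star v * d"] by (simp only: mult.assoc)
  then have "star v * c \<in> E" using E_conj[OF cE, of v] by simp
  then have "star (star v * c) \<in> E" using E_star by blast
  then have "star c * v \<in> E" by (simp add: star_mult star_star)
  then show ?thesis using that eq by blast
qed

theorem weyl_topology_ex1:
  assumes weyl: "weyl_star_semigroup star E" and F: "uniformity_family F"
    and act: "is_action act" and uc: "uniformly_continuous_action F act"
    and eqv: "equivariant_on E act \<Psi>"
  shows "\<exists>!T. topspace T = weyl_bundle star E F act \<Psi> \<and>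
    (\<forall>p \<in> weyl_bundle star E F act \<Psi>. nhood_subbase_at T p (weyl_subbase star E F act \<Psi> p))"
proof (rule nhood_subbase_topology_ex1)
  interpret weyl_star_semigroup star E by (rule weyl)
  let ?W = "weyl_bundle star E F act \<Psi>" and ?B = "weyl_subbase star E F act \<Psi>"
  let ?cl = "\<lambda>U x. equiv_at star F act \<Psi> U `` {x}"
  let ?N = "weyl_nhood star E F act \<Psi>"
  have reflF: "(x, x) \<in> R" and symF: "(x, y) \<in> R \<Longrightarrow> (y, x) \<in> R" if "R \<in> F" for R x y
    using F that unfolding uniformity_family_def filter_in_def refl_on_def sym_def by blast+
  have ne: "U \<noteq> {}"
    and up: "weyl_prec star E c a \<Longrightarrow> c \<in> U \<Longrightarrow> a \<in> U"
    and dir: "a \<in> U \<Longrightarrow> b \<in> U \<Longrightarrow> \<exists>c\<in>U. weyl_prec star E c a \<and> weyl_prec star E c b"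
    if "U \<in> weyl_ultrafilters star E" for U a b c
    using that unfolding weyl_ultrafilters_def ultrafilter_in_def filter_in_def by blast+
  fix p N assume p: "p \<in> ?W" and N: "N \<in> ?B p"
  obtain U x where U: "U \<in> weyl_ultrafilters star E" and pU: "p = (U, ?cl U x)"
    using p unfolding weyl_bundle_def by blast
  obtain y s R where s: "s \<in> U" and y: "y \<in> ?cl U x" and R: "R \<in> F" and NN: "N = ?N y s R"
    using N unfolding weyl_subbase_def pU by auto
  show "p \<in> N"
  proof -
    have "(x, y) \<in> rel_at star act \<Psi> U R" using y R by (auto simp: equiv_at_def)
    then have "(y, x) \<in> rel_at star act \<Psi> U R" using symF[OF R] unfolding rel_at_def by blast
    then show ?thesis unfolding NN weyl_nhood_def pU using U s by blast
  qed
  obtain Q where Q: "Q \<in> F" "Q O Q \<subseteq> R" using F R unfolding uniformity_family_def by blast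
  obtain P where P0: "P \<in> F" "{(act t a, act t b) | t a b. (a, b) \<in> P} \<subseteq> Q"
    using uc Q(1) unfolding uniformly_continuous_action_def by meson
  have P: "P \<in> F" "\<And>t a b. (a, b) \<in> P \<Longrightarrow> (act t a, act t b) \<in> Q"
    using P0(1) by assumption (rule subsetD[OF P0(2)], blast)
  have shrink: "(\<Psi> (act (star c) a), \<Psi> (act (star c) b)) \<in> Q"
    if cv: "weyl_prec star E c v" and ab: "(\<Psi> (act (star v) a), \<Psi> (act (star v) b)) \<in> P"
    for c v a b
  proof -
    obtain e where e: "e \<in> E" "star c = e * star v" using weyl_prec_eq_right_mult[OF cv] .
    have "\<Psi> (act (star c) d) = act e (\<Psi> (act (star v) d))" for d
      using e act eqv by (simp add: is_action_def equivariant_on_def)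
    then show ?thesis using P(2)[OF ab] by simp
  qed
  show "\<exists>C\<in>?B p. \<forall>q\<in>?W \<inter> C. \<exists>D\<in>?B q. D \<subseteq> N"
  proof (rule bexI[of _ "?N y s P"], rule ballI)
    show "?N y s P \<in> ?B p" unfolding weyl_subbase_def pU using s y P(1) by blast
  next
    fix q assume "q \<in> ?W \<inter> ?N y s P"
    then obtain V z where V: "V \<in> weyl_ultrafilters star E" "s \<in> V" and q: "q = (V, ?cl V z)"
      and yz: "(y, z) \<in> rel_at star act \<Psi> V P"
      unfolding weyl_nhood_def by blast
    obtain v where v: "v \<in> V" "(\<Psi> (act (star v) y), \<Psi> (act (star v) z)) \<in> P"
      using yz unfolding rel_at_def by blast
    obtain t where t: "t \<in> V" "weyl_prec star E t s" "weyl_prec star E t v"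
      using dir[OF V(1) V(2) v(1)] by blast
    have zz: "z \<in> ?cl V z" using reflF ne[OF V(1)] unfolding equiv_at_def rel_at_def by auto
    show "\<exists>D\<in>?B q. D \<subseteq> N"
    proof (rule bexI[of _ "?N z t P"], rule subsetI)
      show "?N z t P \<in> ?B q" unfolding weyl_subbase_def q using t(1) zz P(1) by blast
    next
      fix r assume "r \<in> ?N z t P"
      then obtain V' w where V': "V' \<in> weyl_ultrafilters star E" "t \<in> V'" and r: "r = (V', ?cl V' w)"
        and zw: "(z, w) \<in> rel_at star act \<Psi> V' P"
        unfolding weyl_nhood_def by blast
      obtain v' where v': "v' \<in> V'" "(\<Psi> (act (star v') z), \<Psi> (act (star v') w)) \<in> P"
        using zw unfolding rel_at_def by blast
      have sv: "s \<in> V'" "v \<in> V'" using up[OF V'(1)] t V'(2) by blast+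
      obtain c where c: "c \<in> V'" "weyl_prec star E c v" "weyl_prec star E c v'"
        using dir[OF V'(1) sv(2) v'(1)] by blast
      have "(\<Psi> (act (star c) y), \<Psi> (act (star c) w)) \<in> R"
        using shrink[OF c(2) v(2)] shrink[OF c(3) v'(2)] Q(2) by blast
      then have "(y, w) \<in> rel_at star act \<Psi> V' R" using c(1) unfolding rel_at_def by blast
      then show "r \<in> N" unfolding NN weyl_nhood_def r using V'(1) sv(1) by blast
    qed
  qed
qed

end

theory Submission
  imports Defs
begin

text \<open>
  Continuity at \<open>U\<close> only has to be tested against a neighbourhood subbase at \<open>(U, x\<^sup>\<equiv>)\<close>, that is,
  against the sets \<open>y\<^sub>s\<^sup>R\<close> with \<open>s \<in> U\<close>, \<open>x \<equiv>\<^sub>U y\<close> and \<open>R \<in> F\<close>.  The definition of \<open>x \<equiv>\<^sub>U y\<close>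
  provides one element \<open>v \<in> U\<close> such that \<open>\<Psi> (v\<^sup>* x)\<close> and \<open>\<Psi> (v\<^sup>* y)\<close> are \<open>R\<close>-related.  This relation
  does not mention \<open>U\<close>: the same \<open>v\<close> witnesses that \<open>y\<close> and \<open>x\<close> are related at every ultrafilter
  containing \<open>v\<close>.  Hence the section maps the basic open set of all ultrafilters containing both \<open>s\<close>
  and \<open>v\<close> into \<open>y\<^sub>s\<^sup>R\<close>.

  That the sets \<open>y\<^sub>s\<^sup>R\<close> are neighbourhood subbases of a topology at all is \<open>weyl_topology_ex1\<close>;
  it rests on the axioms of a Weyl \<open>*\<close>-semigroup, uniform continuity and equivariance.
\<close>

text \<open>Preimages commute with finite intersections, so a neighbourhood subbase at the image point
  suffices to test continuity.\<close>

lemma continuous_map_if_nhood_subbase: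
  assumes sb: "\<And>a. a \<in> topspace T \<Longrightarrow> nhood_subbase_at T' (f a) (B a)"
    and top: "\<And>a. a \<in> topspace T \<Longrightarrow> f a \<in> topspace T'"
    and nb: "\<And>a N. a \<in> topspace T \<Longrightarrow> N \<in> B a \<Longrightarrow> \<exists>A. openin T A \<and> a \<in> A \<and> f ` A \<subseteq> N"
  shows "continuous_map T T' f"
  unfolding continuous_map_def
proof (intro conjI allI impI)
  show "f \<in> topspace T \<rightarrow> topspace T'" using top by blast
next
  fix V assume V: "openin T' V"
  show "openin T {a \<in> topspace T. f a \<in> V}"
  proof (subst openin_subopen, intro ballI)
    fix a assume "a \<in> {a \<in> topspace T. f a \<in> V}"
    then have a: "a \<in> topspace T" and fa: "f a \<in> V" by auto
    obtain G where G: "finite G" "G \<subseteq> B a" "topspace T' \<inter> \<Inter>G \<subseteq> V"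
      using sb[OF a] V fa unfolding nhood_subbase_at_def by blast
    have "\<forall>N\<in>G. \<exists>A. openin T A \<and> a \<in> A \<and> f ` A \<subseteq> N" using nb[OF a] G(2) by blast
    then obtain h where h: "\<And>N. N \<in> G \<Longrightarrow> openin T (h N) \<and> a \<in> h N \<and> f ` h N \<subseteq> N" by metis
    \<comment> \<open>The total space is added because \<open>G\<close> may be empty.\<close>
    define A where "A = \<Inter>(insert (topspace T) (h ` G))"
    have "openin T A" unfolding A_def using G(1) h by (intro openin_Inter) auto
    moreover have "a \<in> A" unfolding A_def using a h by auto
    moreover have "A \<subseteq> {a \<in> topspace T. f a \<in> V}"
    proof
      fix b assume b: "b \<in> A"
      then have "b \<in> topspace T" "\<And>N. N \<in> G \<Longrightarrow> f b \<in> N" unfolding A_def using h by blast+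
      then show "b \<in> {a \<in> topspace T. f a \<in> V}" using G(3) top by blast
    qed
    ultimately show "\<exists>A. openin T A \<and> a \<in> A \<and> A \<subseteq> {a \<in> topspace T. f a \<in> V}" by blast
  qed
qed

lemma openin_ultrafilters_containing:
  "openin (ultrafilter_topology star E) {U \<in> weyl_ultrafilters star E. a \<in> U}"
  unfolding ultrafilter_topology_def by (intro topology_generated_by_Basis) blast

lemma weyl_topology_nhood_subbase:
  assumes "weyl_star_semigroup star E" "uniformity_family F" "is_action act"
    and "uniformly_continuous_action F act" "equivariant_on E act \<Psi>"
  shows "topspace (weyl_topology star E F act \<Psi>) = weyl_bundle star E F act \<Psi>"
    and "p \<in> weyl_bundle star E F act \<Psi> \<Longrightarrow>
      nhood_subbase_at (weyl_topology star E F act \<Psi>) p (weyl_subbase star E F act \<Psi> p)"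
  using theI'[OF weyl_topology_ex1[OF assms]] unfolding weyl_topology_def by blast+

text \<open>The local form of continuity: a witness \<open>v\<close> of the relation between \<open>x\<close> and \<open>y\<close> at \<open>U\<close> is
  still one at all ultrafilters near \<open>U\<close>.\<close>

lemma section_locally_into_weyl_nhood:
  assumes F: "uniformity_family F" and U: "U \<in> weyl_ultrafilters star E"
    and N: "N \<in> weyl_subbase star E F act \<Psi> (U, equiv_at star F act \<Psi> U `` {x})"
  obtains A where "openin (ultrafilter_topology star E) A" "U \<in> A"
    "(\<lambda>U. (U, equiv_at star F act \<Psi> U `` {x})) ` A \<subseteq> N"
proof -
  obtain y s R where s: "s \<in> U" and y: "(x, y) \<in> equiv_at star F act \<Psi> U" and R: "R \<in> F"
    and NN: "N = weyl_nhood star E F act \<Psi> y s R"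
    using N unfolding weyl_subbase_def by auto
  obtain v where v: "v \<in> U" "(\<Psi> (act (star v) x), \<Psi> (act (star v) y)) \<in> R"
    using y R unfolding equiv_at_def rel_at_def by blast
  \<comment> \<open>The relation defining \<open>y\<^sub>s\<^sup>R\<close> has \<open>y\<close> on the left, so the witness has to be reversed.\<close>
  have "sym R" using F R unfolding uniformity_family_def filter_in_def by blast
  then have vR: "(\<Psi> (act (star v) y), \<Psi> (act (star v) x)) \<in> R" using v(2) by (rule symD)
  let ?O = "\<lambda>a. {U \<in> weyl_ultrafilters star E. a \<in> U}"
  show ?thesis
  proof (rule that)
    show "openin (ultrafilter_topology star E) (?O s \<inter> ?O v)"
      by (intro openin_Int openin_ultrafilters_containing)
    show "U \<in> ?O s \<inter> ?O v" using U s v(1) by blast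
    show "(\<lambda>U. (U, equiv_at star F act \<Psi> U `` {x})) ` (?O s \<inter> ?O v) \<subseteq> N"
      using vR unfolding NN weyl_nhood_def rel_at_def by blast
  qed
qed

theorem proposition2p53:
  fixes star :: "'s::semigroup_mult \<Rightarrow> 's" and E :: "'s set"
    and F :: "'x rel set" and act :: "'s \<Rightarrow> 'x \<Rightarrow> 'x" and \<Psi> :: "'x \<Rightarrow> 'x" and x :: 'x
  assumes "weyl_star_semigroup star E"
    and "uniformity_family F"
    and "is_action act"
    and "uniformly_continuous_action F act"
    and "equivariant_on E act \<Psi>"
  shows "continuous_section (ultrafilter_topology star E) (weyl_topology star E F act \<Psi>) fst
           (\<lambda>U. (U, equiv_at star F act \<Psi> U `` {x}))"
proof -
  let ?\<sigma> = "\<lambda>U. (U, equiv_at star F act \<Psi> U `` {x})"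
  have \<sigma>: "?\<sigma> U \<in> weyl_bundle star E F act \<Psi>" if "U \<in> weyl_ultrafilters star E" for U
    using that unfolding weyl_bundle_def by blast
  have "continuous_map (ultrafilter_topology star E) (weyl_topology star E F act \<Psi>) ?\<sigma>"
  proof (rule continuous_map_if_nhood_subbase, unfold topspace_ultrafilter_topology)
    fix U assume U: "U \<in> weyl_ultrafilters star E"
    show "?\<sigma> U \<in> topspace (weyl_topology star E F act \<Psi>)"
      unfolding weyl_topology_nhood_subbase(1)[OF assms] by (rule \<sigma>[OF U])
    show "nhood_subbase_at (weyl_topology star E F act \<Psi>) (?\<sigma> U)
            (weyl_subbase star E F act \<Psi> (?\<sigma> U))"
      by (rule weyl_topology_nhood_subbase(2)[OF assms \<sigma>[OF U]])
    fix N assume "N \<in> weyl_subbase star E F act \<Psi> (?\<sigma> U)"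
    from section_locally_into_weyl_nhood[OF assms(2) U this]
    show "\<exists>A. openin (ultrafilter_topology star E) A \<and> U \<in> A \<and> ?\<sigma> ` A \<subseteq> N" by metis
  qed
  then show ?thesis unfolding continuous_section_def by simp
qed

end
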